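(* Problems (L) and (F) have the same optimal value, and their global minimizers can be transformed into each other, i.e. $$V_{(L)}=V_{(F)}\quad\text{and}\quad \mathcal{G}_{(L)}=\{(XY^{\mathbb{T}},S):(X,Y,S)\in\mathcal{G}_{(F)}\}.$$
   Context: Let $m,n,d$ be positive integers, $\lambda,\beta\ge 0$, and let $f:\mathbb{R}^{m\times n}\times\mathbb{R}^{m\times n}\to[0,+\infty)$ be locally Lipschitz continuous. For a matrix $S$, $\|S\|_0$ is the number of nonzero entries; $\mathrm{nnzc}(X)$ is the number of nonzero columns of $X$. Let $\mathcal{B}^S:=\{S\in\mathbb{R}^{m\times n}:\kappa^1_{ij}\le S_{ij}\le\kappa^2_{ij}\ \forall i,j\}$ with given $\kappa^1_{ij}\in[-\infty,0]$, $\kappa^2_{ij}\in[0,+\infty]$. Problem (L): minimize $F_0(Z,S):=f(Z,S)+2\lambda\,\mathrm{rank}(Z)+\beta\|S\|_0$ over $(Z,S)\in\mathbb{R}^{m\times n}\times\mathcal{B}^S$ with $\mathrm{rank}(Z)\le d$. Problem (F): minimize $F(X,Y,S):=f(XY^{\mathbb{T}},S)+\lambda(\mathrm{nnzc}(X)+\mathrm{nnzc}(Y))+\beta\|S\|_0$ over $(X,Y,S)\in\mathbb{R}^{m\times d}\times\mathbb{R}^{n\times d}\times\mathcal{B}^S$. For a problem $(P)$, $V_{(P)}$ denotes its optimal value (infimum) and $\mathcal{G}_{(P)}$ its set of global minimizers. *)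

theory Defs
  imports "HOL-Analysis.Analysis"
begin

text \<open>
  Compare \<^const>\<open>local_lipschitz\<close>, which is about functions with an additional time parameter.
\<close>

definition locally_lipschitz :: "('a::metric_space \<Rightarrow> 'b::metric_space) \<Rightarrow> bool" where
  "locally_lipschitz f \<longleftrightarrow> (\<forall>x. \<exists>r>0. \<exists>L. L-lipschitz_on (ball x r) f)"

definition l0_norm :: "real^'n^'m \<Rightarrow> nat" where
  "l0_norm S = card {(i, j). S $ i $ j \<noteq> 0}"

definition nnzc :: "real^'n^'m \<Rightarrow> nat" where
  "nnzc X = card {j. column j X \<noteq> 0}"

text \<open>The bounds are extended reals, since they may be infinite.\<close>

definition box_constraint :: "ereal^'n^'m \<Rightarrow> ereal^'n^'m \<Rightarrow> (real^'n^'m) set" where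
  "box_constraint \<kappa>1 \<kappa>2 =
     {S. \<forall>i j. \<kappa>1 $ i $ j \<le> ereal (S $ i $ j) \<and> ereal (S $ i $ j) \<le> \<kappa>2 $ i $ j}"

text \<open>
  The optimal value lives in the extended reals, because the infimum of a set of reals that is
  empty or unbounded below is an arbitrary value.
\<close>

definition optimal_value :: "('a \<Rightarrow> real) \<Rightarrow> 'a set \<Rightarrow> ereal" where
  "optimal_value obj C = (INF x\<in>C. ereal (obj x))"

definition global_minimizers :: "('a \<Rightarrow> real) \<Rightarrow> 'a set \<Rightarrow> 'a set" where
  "global_minimizers obj C = {x. is_arg_min obj (\<lambda>y. y \<in> C) x}"

definition L_objective ::
  "((real^'n^'m) \<times> (real^'n^'m) \<Rightarrow> real) \<Rightarrow> real \<Rightarrow> real \<Rightarrow> (real^'n^'m) \<times> (real^'n^'m) \<Rightarrow> real" where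
  "L_objective f lam \<beta> =
     (\<lambda>(Z, S). f (Z, S) + 2 * lam * real (rank Z) + \<beta> * real (l0_norm S))"

definition L_feasible ::
  "nat \<Rightarrow> ereal^'n^'m \<Rightarrow> ereal^'n^'m \<Rightarrow> ((real^'n^'m) \<times> (real^'n^'m)) set" where
  "L_feasible d \<kappa>1 \<kappa>2 = {(Z, S). S \<in> box_constraint \<kappa>1 \<kappa>2 \<and> rank Z \<le> d}"

definition F_objective ::
  "((real^'n^'m) \<times> (real^'n^'m) \<Rightarrow> real) \<Rightarrow> real \<Rightarrow> real
     \<Rightarrow> (real^'d^'m) \<times> (real^'d^'n) \<times> (real^'n^'m) \<Rightarrow> real" where
  "F_objective f lam \<beta> =
     (\<lambda>(X, Y, S). f (X ** transpose Y, S) + lam * (real (nnzc X) + real (nnzc Y))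
        + \<beta> * real (l0_norm S))"

definition F_feasible ::
  "ereal^'n^'m \<Rightarrow> ereal^'n^'m \<Rightarrow> ((real^'d^'m) \<times> (real^'d^'n) \<times> (real^'n^'m)) set" where
  "F_feasible \<kappa>1 \<kappa>2 = {(X, Y, S). S \<in> box_constraint \<kappa>1 \<kappa>2}"

end

theory Submission
  imports Defs
begin

text \<open>
  The map \<open>(X, Y, S) \<mapsto> (X Y\<^sup>T, S)\<close> sends feasible points of (F) to feasible points of (L)
  without increasing the objective, because the rank of \<open>X Y\<^sup>T\<close> is at most the number of nonzero
  columns of either factor. Conversely, expanding the columns of \<open>Z\<close> in a basis of its column
  space gives a factorization with at most \<open>rank Z\<close> nonzero columns in each factor, so every
  feasible point of (L) has a preimage whose objective is not larger.
\<close>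

text \<open>Zero columns lie in every span, so the nonzero ones span the column space. Repeated
  columns collapse in the image \<open>?C\<close>, which can only lower its cardinality.\<close>

lemma rank_le_nnzc: "rank X \<le> nnzc X" for X :: "real^'n^'m"
proof -
  let ?C = "(\<lambda>j. column j X) ` {j. column j X \<noteq> 0}"
  have "columns X \<subseteq> span ?C"
    by (auto simp: columns_def intro: span_base span_zero)
      (metis (mono_tags, lifting) image_eqI mem_Collect_eq span_base span_zero)
  then have "rank X \<le> card ?C"
    unfolding column_rank_def by (intro dim_le_card) simp_all
  also have "\<dots> \<le> nnzc X"
    unfolding nnzc_def by (rule card_image_le) simp
  finally show ?thesis .
qed

lemma rank_mult_transpose_le_nnzc:
  fixes X :: "real^'d^'m" and Y :: "real^'d^'n"
  shows "rank (X ** transpose Y) \<le> nnzc X" and "rank (X ** transpose Y) \<le> nnzc Y"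
  using rank_mul_le_left[of X "transpose Y"] rank_mul_le_right[of X "transpose Y"]
    rank_le_nnzc[of X] rank_le_nnzc[of Y]
  by (simp_all add: rank_transpose)

lemma nnzc_le_card_support:
  fixes X :: "real^'d^'m"
  assumes "\<And>i k. k \<notin> K \<Longrightarrow> X $ i $ k = 0"
  shows "nnzc X \<le> card K"
  unfolding nnzc_def using assms by (intro card_mono) (auto simp: column_def vec_eq_iff)

lemma rank_factorization:
  fixes Z :: "real^'n^'m"
  assumes "rank Z \<le> CARD('d::finite)"
  obtains X :: "real^'d^'m" and Y :: "real^'d^'n"
  where "X ** transpose Y = Z" "nnzc X \<le> rank Z" "nnzc Y \<le> rank Z"
proof -
  obtain B where B: "columns Z \<subseteq> span B" "card B = rank Z" "independent B"
    using basis_exists[of "columns Z"] by (metis column_rank_def)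
  have fin: "finite B"
    using B(3) by (rule independent_imp_finite)
  \<comment> \<open>The rank bound enters here: it leaves room to give each basis vector its own
    column index in \<open>'d\<close>.\<close>
  obtain e :: "real^'m \<Rightarrow> 'd" where e: "inj_on e B"
    using card_le_inj[OF fin, of "UNIV :: 'd set"] B(2) assms by auto
  have "\<exists>u. column j Z = (\<Sum>b\<in>B. u b *\<^sub>R b)" for j
  proof -
    have "column j Z \<in> span B"
      using B(1) by (auto simp: columns_def)
    then show ?thesis
      by (auto simp: span_finite[OF fin])
  qed
  then obtain u where u: "\<And>j. column j Z = (\<Sum>b\<in>B. u j b *\<^sub>R b)"
    by metis
  \<comment> \<open>Column \<open>e b\<close> of \<open>X\<close> is the basis vector
    \<open>b\<close>, and column \<open>e b\<close> of \<open>Y\<close> lists the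
    \<open>b\<close>-coordinates of the columns of \<open>Z\<close>. Filling all other columns with
    0 is what keeps both \<open>nnzc\<close> values within the rank.\<close>
  define X :: "real^'d^'m"
    where "X = (\<chi> i k. if k \<in> e ` B then the_inv_into B e k $ i else 0)"
  define Y :: "real^'d^'n"
    where "Y = (\<chi> j k. if k \<in> e ` B then u j (the_inv_into B e k) else 0)"
  have "(X ** transpose Y) $ i $ j = Z $ i $ j" for i j
  proof -
    have "(X ** transpose Y) $ i $ j = (\<Sum>k\<in>e ` B. X $ i $ k * Y $ j $ k)"
      unfolding matrix_matrix_mult_def transpose_def vec_lambda_beta
      by (intro sum.mono_neutral_right) (auto simp: X_def)
    also have "\<dots> = (\<Sum>b\<in>B. u j b * b $ i)"
      by (simp add: sum.reindex[OF e] X_def Y_def the_inv_into_f_f[OF e] mult.commute)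
    also have "\<dots> = column j Z $ i"
      by (simp add: u)
    finally show ?thesis
      by (simp add: column_def)
  qed
  moreover have "card (e ` B) = rank Z"
    using card_image[OF e] B(2) by simp
  moreover have "nnzc X \<le> card (e ` B)" "nnzc Y \<le> card (e ` B)"
    by (rule nnzc_le_card_support; simp add: X_def Y_def)+
  ultimately show thesis
    by (intro that[of X Y]) (simp_all add: vec_eq_iff)
qed

lemma global_minimizers_iff:
  "x \<in> global_minimizers obj C \<longleftrightarrow> x \<in> C \<and> (\<forall>y\<in>C. obj x \<le> obj y)"
  by (auto simp: global_minimizers_def is_arg_min_linorder)

lemma optimal_value_eq_of_reduction:
  assumes "\<And>x. x \<in> D \<Longrightarrow> \<exists>y\<in>C. obj y \<le> obj' x"
    and "\<And>y. y \<in> C \<Longrightarrow> \<exists>x\<in>D. obj' x \<le> obj y"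
  shows "optimal_value obj C = optimal_value obj' D"
  unfolding optimal_value_def by (rule antisym; rule INF_mono) (use assms in auto)

text \<open>The lift has to be an exact preimage under \<open>g\<close>: a point that is merely no
  worse would give equal optimal values, but would not show that every minimizer on \<open>C\<close>
  has the form \<open>g x\<close>.\<close>

lemma global_minimizers_eq_image:
  assumes g: "\<And>x. x \<in> D \<Longrightarrow> g x \<in> C \<and> obj (g x) \<le> obj' x"
    and lift: "\<And>y. y \<in> C \<Longrightarrow> \<exists>x\<in>D. g x = y \<and> obj' x \<le> obj y"
  shows "global_minimizers obj C = g ` global_minimizers obj' D"
proof (intro set_eqI iffI)
  fix y assume y: "y \<in> global_minimizers obj C"
  then obtain x where "x \<in> D" "g x = y" "obj' x \<le> obj y"
    using lift by (auto simp: global_minimizers_iff)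
  \<comment> \<open>Pass through \<open>g x'\<close>:
    \<open>obj y \<le> obj (g x') \<le> obj' x'\<close>. With \<open>obj' x \<le> obj y\<close> this
    makes \<open>x\<close> minimal.\<close>
  moreover have "obj y \<le> obj' x'" if "x' \<in> D" for x'
    using y g[OF that] by (force simp: global_minimizers_iff)
  ultimately show "y \<in> g ` global_minimizers obj' D"
    by (force simp: global_minimizers_iff)
next
  fix y assume "y \<in> g ` global_minimizers obj' D"
  then obtain x where x: "x \<in> D" "y = g x" "\<And>x'. x' \<in> D \<Longrightarrow> obj' x \<le> obj' x'"
    by (auto simp: global_minimizers_iff)
  \<comment> \<open>For a lift \<open>x'\<close> of \<open>z\<close>, the chain is
    \<open>obj y \<le> obj' x \<le> obj' x' \<le> obj z\<close>.\<close>
  have "obj y \<le> obj z" if "z \<in> C" for z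
    using lift[OF that] g[OF x(1)] x(2,3) by fastforce
  then show "y \<in> global_minimizers obj C"
    using g x by (auto simp: global_minimizers_iff)
qed

theorem proposition1:
  fixes f :: "(real^'n^'m) \<times> (real^'n^'m) \<Rightarrow> real"
    and lam \<beta> :: real
    and \<kappa>1 \<kappa>2 :: "ereal^'n^'m"
  assumes "lam \<ge> 0" and "\<beta> \<ge> 0"
    and "\<And>p. f p \<ge> 0"
    and "locally_lipschitz f"
    and "\<And>i j. \<kappa>1 $ i $ j \<le> 0"
    and "\<And>i j. \<kappa>2 $ i $ j \<ge> 0"
  shows "optimal_value (L_objective f lam \<beta>) (L_feasible CARD('d::finite) \<kappa>1 \<kappa>2) =
           optimal_value (F_objective f lam \<beta>)
             (F_feasible \<kappa>1 \<kappa>2 :: ((real^'d^'m) \<times> (real^'d^'n) \<times> (real^'n^'m)) set) \<and>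
         global_minimizers (L_objective f lam \<beta>) (L_feasible CARD('d) \<kappa>1 \<kappa>2) =
           {(X ** transpose Y, S) | X Y S.
              (X, Y, S) \<in> global_minimizers (F_objective f lam \<beta>)
                (F_feasible \<kappa>1 \<kappa>2 :: ((real^'d^'m) \<times> (real^'d^'n) \<times> (real^'n^'m)) set)}"
proof -
  let ?C = "L_feasible CARD('d) \<kappa>1 \<kappa>2"
  let ?D = "F_feasible \<kappa>1 \<kappa>2 :: ((real^'d^'m) \<times> (real^'d^'n) \<times> (real^'n^'m)) set"
  let ?L = "L_objective f lam \<beta>"
  let ?F = "F_objective f lam \<beta> :: (real^'d^'m) \<times> (real^'d^'n) \<times> (real^'n^'m) \<Rightarrow> real"
  define g :: "(real^'d^'m) \<times> (real^'d^'n) \<times> (real^'n^'m) \<Rightarrow> (real^'n^'m) \<times> (real^'n^'m)"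
    where "g = (\<lambda>(X, Y, S). (X ** transpose Y, S))"
  have g: "g p \<in> ?C \<and> ?L (g p) \<le> ?F p" if "p \<in> ?D" for p
  proof -
    obtain X Y S where p: "p = (X, Y, S)"
      by (cases p) auto
    \<comment> \<open>This yields the rank constraint of (L) for the product.\<close>
    have "nnzc X \<le> CARD('d)"
      unfolding nnzc_def by (rule card_mono) auto
    \<comment> \<open>Each factor bounds the rank separately; adding the two bounds accounts for the
      2 in the objective of (L).\<close>
    moreover have "lam * (2 * real (rank (X ** transpose Y))) \<le> lam * (real (nnzc X) + real (nnzc Y))"
      using rank_mult_transpose_le_nnzc[of X Y] \<open>lam \<ge> 0\<close> by (intro mult_left_mono) auto
    ultimately show ?thesis
      using that rank_mult_transpose_le_nnzc(1)[of X Y]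
      by (auto simp: p g_def L_feasible_def F_feasible_def L_objective_def F_objective_def)
  qed
  have lift: "\<exists>p\<in>?D. g p = q \<and> ?F p \<le> ?L q" if "q \<in> ?C" for q
  proof -
    obtain Z S where q: "q = (Z, S)"
      by (cases q) auto
    have "rank Z \<le> CARD('d)"
      using that by (simp add: q L_feasible_def)
    then obtain X :: "real^'d^'m" and Y :: "real^'d^'n"
      where XY: "X ** transpose Y = Z" "nnzc X \<le> rank Z" "nnzc Y \<le> rank Z"
      by (rule rank_factorization)
    have "lam * (real (nnzc X) + real (nnzc Y)) \<le> lam * (2 * real (rank Z))"
      using XY \<open>lam \<ge> 0\<close> by (intro mult_left_mono) auto
    then show ?thesis
      using that XY(1)
      by (intro bexI[of _ "(X, Y, S)"])
        (auto simp: q g_def L_feasible_def F_feasible_def L_objective_def F_objective_def)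
  qed
  have "optimal_value ?L ?C = optimal_value ?F ?D"
    by (rule optimal_value_eq_of_reduction) (use g lift in blast)+
  moreover have "global_minimizers ?L ?C = g ` global_minimizers ?F ?D"
    by (rule global_minimizers_eq_image[OF g lift])
  moreover have "g ` global_minimizers ?F ?D =
      {(X ** transpose Y, S) | X Y S. (X, Y, S) \<in> global_minimizers ?F ?D}"
    by (force simp: g_def image_iff)
  ultimately show ?thesis
    by simp
qed

end
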